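(* Let $a,b$ be two torically incomparable elements in the toric poset $[Q]$. (i) If $a,b$ are in different connected components of the underlying graph of $[Q]$, then $[Q_{a\to b}]=[Q_{b\to a}]$ and $\mathcal{L}_{\rm tor}([Q])=\mathcal{L}_{\rm tor}([Q_{a\to b}])=\mathcal{L}_{\rm tor}([Q_{b\to a}])$. (ii) If $a,b$ are in the same connected component of the underlying graph of $[Q]$ and $Q'\in[Q]$ is a representative in which $a,b$ are (ordinary) incomparable, then $\mathcal{L}_{\rm tor}([Q'_{a\to b}])$ and $\mathcal{L}_{\rm tor}([Q'_{b\to a}])$ are disjoint subsets of $\mathcal{L}_{\rm tor}([Q])$; but the inclusion $\mathcal{L}_{\rm tor}([Q'_{a\to b}])\sqcup\mathcal{L}_{\rm tor}([Q'_{b\to a}])\subseteq\mathcal{L}_{\rm tor}([Q])$ may be proper (i.e. there exist such $Q,a,b,Q'$ for which it is proper). (iii) Assume that $a,b$ are at distance two in the underlying graph of the toric transitive closure $\overline{[Q]}$, say both adjacent to the vertex $v$. If $Q'\in\overline{[Q]}_v$, that is, $Q'$ is a representative of $\overline{[Q]}$ having $v$ as a source, then $$\mathcal{L}_{\rm tor}([Q])=\mathcal{L}_{\rm tor}([Q'_{a\to b}])\sqcup\mathcal{L}_{\rm tor}([Q'_{b\to a}]).$$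
   Context: All quivers are finite directed graphs that are simple (no loops, no parallel or anti-parallel arcs) and acyclic (no directed cycles), on a vertex set $V=[n]$. A source is a vertex all of whose incident arcs point away from it; a sink is a vertex all of whose incident arcs point into it (an isolated vertex is both). A flip at a source or sink $k$ reverses all arcs incident to $k$. Two acyclic quivers are equivalent if they are related by a finite sequence of flips; the equivalence class $[Q]$ is called a toric poset; all its members have the same underlying undirected graph. A quiver $Q$ induces a poset on $V$ by $i<j$ if there is a directed path from $i$ to $j$; "ordinary (in)comparable" refers to this poset. If neither $a\to b$ nor $b\to a$ is in $Q$, then $Q_{a\to b}$ is $Q$ with the arc $a\to b$ added (similarly $Q_{b\to a}$). A toric directed path in $Q'$ is a sequence of distinct vertices $y_1,\dots,y_m$ such that $Q'$ contains the arcs $y_1\to y_2\to\cdots\to y_m$ and also the arc $y_1\to y_m$ (a single vertex and a single arc also count). A toric chain of $[Q]$ is a subset of $V$ that is totally ordered in the poset induced by every quiver in $[Q]$; it is known that a subset is a toric chain if and only if its elements lie on a common toric directed path (in one, equivalently every, $Q'\in[Q]$). Two elements are torically comparable if they lie on a common toric chain, and torically incomparable otherwise. For $Q'\in[Q]$, the toric transitive closure $\overline{Q'}$ is obtained from $Q'$ by adding, for all $i,j$ lying on a common toric chain, the arc $i\to j$ where $i$ precedes $j$ along a toric directed path of $Q'$ containing both. The toric transitive closure of $[Q]$ is $\overline{[Q]}:=[\overline{Q'}]$, known to be independent of the choice of $Q'\in[Q]$. $\overline{[Q]}_v$ is the set of quivers in $\overline{[Q]}$ having $v$ as a source. A toric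 total order $[w]=[(w_1,\dots,w_n)]$ is the equivalence class of a permutation of $V$ under cyclic rotation. For a graph $G$ on $V$, let $\mathcal{A}_{\rm tor}(G)$ be the image in $\mathbb{R}^n/\mathbb{Z}^n$ of $\bigcup_{\{i,j\}\in G}\{x_i=x_j\}\subset\mathbb{R}^n$. A point of $\mathbb{R}^n/\mathbb{Z}^n-\mathcal{A}_{\rm tor}(G)$ determines an acyclic orientation of $G$: $i\to j$ if $x_i \bmod 1< x_j \bmod 1$ (values in $[0,1)$), and $j\to i$ otherwise. For a toric poset $[Q]$ with underlying graph $G$, its toric chamber $c_{[Q]}$ is the set of points whose orientation lies in $[Q]$ (these sets are exactly the connected components of $\mathbb{R}^n/\mathbb{Z}^n-\mathcal{A}_{\rm tor}(G)$). For a toric total order $[w]$, $c_{[w]}$ is the set of points with pairwise distinct coordinates such that listing the indices in increasing order of $x_i\bmod 1$ gives a member of $[w]$. $[w]$ is a toric total extension of $[Q]$ if $c_{[w]}\subseteq c_{[Q]}$; the set of these is $\mathcal{L}_{\rm tor}([Q])$. *)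

theory Defs
  imports Complex_Main "HOL-Library.FuncSet" "HOL-Combinatorics.Multiset_Permutations"
begin

section \<open>Quivers and toric posets\<close>

text \<open>A quiver on the vertex set \<open>{1..n}\<close> is given by its set of arcs; acyclicity excludes loops
  and anti-parallel arcs.\<close>

definition quiver :: "nat \<Rightarrow> (nat \<times> nat) set \<Rightarrow> bool" where
  "quiver n Q \<longleftrightarrow> Q \<subseteq> {1..n} \<times> {1..n} \<and> acyclic Q"

definition is_source :: "nat \<Rightarrow> (nat \<times> nat) set \<Rightarrow> nat \<Rightarrow> bool" where
  "is_source n Q k \<longleftrightarrow> k \<in> {1..n} \<and> (\<forall>i. (i, k) \<notin> Q)"

definition is_sink :: "nat \<Rightarrow> (nat \<times> nat) set \<Rightarrow> nat \<Rightarrow> bool" where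
  "is_sink n Q k \<longleftrightarrow> k \<in> {1..n} \<and> (\<forall>i. (k, i) \<notin> Q)"

definition flip_at :: "nat \<Rightarrow> (nat \<times> nat) set \<Rightarrow> (nat \<times> nat) set" where
  "flip_at k Q = {(i, j). if i = k \<or> j = k then (j, i) \<in> Q else (i, j) \<in> Q}"

definition flip_rel :: "nat \<Rightarrow> (nat \<times> nat) set rel" where
  "flip_rel n = {(Q, flip_at k Q) |Q k. quiver n Q \<and> (is_source n Q k \<or> is_sink n Q k)}"

definition toric_class :: "nat \<Rightarrow> (nat \<times> nat) set \<Rightarrow> (nat \<times> nat) set set" where
  "toric_class n Q = {Q'. (Q, Q') \<in> (flip_rel n)\<^sup>*}"

text \<open>Below, \<open>P\<close> always stands for a toric poset, i.e. for a set of the form \<open>toric_class n Q\<close>.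
  Its members all have the same underlying undirected graph, so the union taken in
  \<open>class_graph\<close> is that common graph. Graphs are sets of edges \<open>{i, j}\<close>.\<close>

definition class_graph :: "(nat \<times> nat) set set \<Rightarrow> nat set set" where
  "class_graph P = {{i, j} |i j. \<exists>Q\<in>P. (i, j) \<in> Q}"

definition adj_rel :: "nat set set \<Rightarrow> nat rel" where
  "adj_rel G = {(i, j). {i, j} \<in> G}"

definition same_component :: "nat set set \<Rightarrow> nat \<Rightarrow> nat \<Rightarrow> bool" where
  "same_component G i j \<longleftrightarrow> (i, j) \<in> (adj_rel G)\<^sup>*"

definition at_distance :: "nat set set \<Rightarrow> nat \<Rightarrow> nat \<Rightarrow> nat \<Rightarrow> bool" where
  "at_distance G k i j \<longleftrightarrow> (i, j) \<in> adj_rel G ^^ k \<and> (\<forall>l<k. (i, j) \<notin> adj_rel G ^^ l)"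

definition ord_comparable :: "(nat \<times> nat) set \<Rightarrow> nat \<Rightarrow> nat \<Rightarrow> bool" where
  "ord_comparable Q i j \<longleftrightarrow> i = j \<or> (i, j) \<in> Q\<^sup>+ \<or> (j, i) \<in> Q\<^sup>+"


section \<open>Toric chains and the toric transitive closure\<close>

definition toric_chain :: "nat \<Rightarrow> (nat \<times> nat) set set \<Rightarrow> nat set \<Rightarrow> bool" where
  "toric_chain n P C \<longleftrightarrow> C \<subseteq> {1..n} \<and> (\<forall>Q\<in>P. \<forall>i\<in>C. \<forall>j\<in>C. ord_comparable Q i j)"

definition toric_comparable :: "nat \<Rightarrow> (nat \<times> nat) set set \<Rightarrow> nat \<Rightarrow> nat \<Rightarrow> bool" where
  "toric_comparable n P i j \<longleftrightarrow> (\<exists>C. toric_chain n P C \<and> i \<in> C \<and> j \<in> C)"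

definition toric_dipath :: "nat \<Rightarrow> (nat \<times> nat) set \<Rightarrow> nat list \<Rightarrow> bool" where
  "toric_dipath n Q ys \<longleftrightarrow> ys \<noteq> [] \<and> set ys \<subseteq> {1..n} \<and> distinct ys \<and>
     successively (\<lambda>i j. (i, j) \<in> Q) ys \<and> (length ys \<ge> 2 \<longrightarrow> (hd ys, last ys) \<in> Q)"

definition precedes_in :: "'a list \<Rightarrow> 'a \<Rightarrow> 'a \<Rightarrow> bool" where
  "precedes_in ys i j \<longleftrightarrow> (\<exists>k l. k < l \<and> l < length ys \<and> ys ! k = i \<and> ys ! l = j)"

definition toric_closure :: "nat \<Rightarrow> (nat \<times> nat) set \<Rightarrow> (nat \<times> nat) set" where
  "toric_closure n Q = Q \<union> {(i, j). toric_comparable n (toric_class n Q) i j \<and>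
     (\<exists>ys. toric_dipath n Q ys \<and> precedes_in ys i j)}"


section \<open>The torus and toric chambers\<close>

text \<open>Points of \<open>\<real>^n\<close> are extensional functions on \<open>{1..n}\<close>; points of the torus
  \<open>\<real>^n / \<int>^n\<close> are their equivalence classes.\<close>

definition Rn :: "nat \<Rightarrow> (nat \<Rightarrow> real) set" where
  "Rn n = ({1..n} \<rightarrow>\<^sub>E UNIV)"

definition int_cong :: "nat \<Rightarrow> (nat \<Rightarrow> real) rel" where
  "int_cong n = {(x, y). x \<in> Rn n \<and> y \<in> Rn n \<and> (\<forall>i\<in>{1..n}. x i - y i \<in> \<int>)}"

definition torus :: "nat \<Rightarrow> (nat \<Rightarrow> real) set set" where
  "torus n = Rn n // int_cong n"

text \<open>\<open>coord_mod1 p i\<close> is \<open>x i mod 1\<close> (in \<open>[0,1)\<close>), which is the same for all representatives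
  \<open>x \<in> p\<close>.\<close>

definition coord_mod1 :: "(nat \<Rightarrow> real) set \<Rightarrow> nat \<Rightarrow> real" where
  "coord_mod1 p i = the_elem ((\<lambda>x. frac (x i)) ` p)"

definition toric_arrangement :: "nat \<Rightarrow> nat set set \<Rightarrow> (nat \<Rightarrow> real) set set" where
  "toric_arrangement n G =
     (\<lambda>x. int_cong n `` {x}) ` (\<Union>(i, j)\<in>adj_rel G. {x \<in> Rn n. x i = x j})"

text \<open>Off the arrangement, the two coordinates of an edge differ modulo 1, so exactly one of
  \<open>(i, j)\<close> and \<open>(j, i)\<close> is chosen.\<close>

definition point_orientation :: "nat set set \<Rightarrow> (nat \<Rightarrow> real) set \<Rightarrow> (nat \<times> nat) set" where
  "point_orientation G p = {(i, j). {i, j} \<in> G \<and> coord_mod1 p i < coord_mod1 p j}"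

definition toric_chamber :: "nat \<Rightarrow> (nat \<times> nat) set set \<Rightarrow> (nat \<Rightarrow> real) set set" where
  "toric_chamber n P = {p \<in> torus n - toric_arrangement n (class_graph P).
     point_orientation (class_graph P) p \<in> P}"


section \<open>Toric total orders and extensions\<close>

definition rotation_class :: "'a list \<Rightarrow> 'a list set" where
  "rotation_class w = {rotate k w |k. True}"

definition toric_total_orders :: "nat \<Rightarrow> nat list set set" where
  "toric_total_orders n = rotation_class ` permutations_of_set {1..n}"

definition total_order_chamber :: "nat \<Rightarrow> nat list set \<Rightarrow> (nat \<Rightarrow> real) set set" where
  "total_order_chamber n W = {p \<in> torus n. inj_on (coord_mod1 p) {1..n} \<and>
     sort_key (coord_mod1 p) [1..<n+1] \<in> W}"

definition toric_extensions :: "nat \<Rightarrow> (nat \<times> nat) set set \<Rightarrow> nat list set set" where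
  "toric_extensions n P =
     {W \<in> toric_total_orders n. total_order_chamber n W \<subseteq> toric_chamber n P}"

end

theory Submission
  imports Defs
begin

text \<open>Record a sequence of flips by an integer potential \<open>f\<close>, lowered by one at each source flip
  and raised by one at each sink flip. Then \<open>R \<in> [Q]\<close> iff \<open>R\<close> arises from \<open>Q\<close> by reversing the arcs
  along which some \<open>f\<close> with increments in \<open>{0, 1}\<close> jumps. Hence a point with coordinates
  \<open>c i \<in> [0,1)\<close> lies in the chamber of \<open>[Q]\<close> iff \<open>c\<close> has a real lift \<open>X = c + f\<close> with
  \<open>0 < X y - X x < 1\<close> for all arcs \<open>x \<rightarrow> y\<close>. This depends only on the cyclic order of the
  coordinates, so the toric total extensions are the cyclic orders admitting a lift.

  In (i) the lift can be translated by integers on the component of \<open>a\<close> until \<open>X a < X b < X a + 1\<close>.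
  In (ii) two lifts of the same point differ by a constant on a component, so they order \<open>a\<close> and
  \<open>b\<close> in the same way. In (iii) a lift is also a lift of the toric transitive closure, and both
  \<open>X a\<close> and \<open>X b\<close> lie in the unit interval above \<open>X v\<close>.\<close>

section \<open>Flips\<close>

lemma acyclic_if_numbering:
  fixes g :: "nat \<Rightarrow> 'a::order"
  assumes "\<And>x y. (x, y) \<in> Q \<Longrightarrow> g x < g y"
  shows "acyclic Q"
proof -
  have "g x < g y" if "(x, y) \<in> Q\<^sup>+" for x y
    using that by induction (auto intro: assms less_trans)
  then show ?thesis by (force simp: acyclic_def)
qed

text \<open>A vertex is numbered by how many vertices reach it along a nonempty path. Along an arc
  this set grows strictly: it gains the tail of the arc, which by acyclicity does not reach
  itself.\<close>

lemma quiver_numbering: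
  assumes "quiver n Q"
  obtains g :: "nat \<Rightarrow> nat" where "\<And>x y. (x, y) \<in> Q \<Longrightarrow> g x < g y"
proof
  fix x y assume xy: "(x, y) \<in> Q"
  have fin: "finite Q" and ac: "acyclic Q"
    using assms by (auto simp: quiver_def intro: finite_subset)
  have "finite {z. (z, y) \<in> Q\<^sup>+}"
    by (rule finite_subset[of _ "Domain (Q\<^sup>+)"]) (use fin in \<open>auto simp: finite_Domain simp del: trancl_domain\<close>)
  moreover have "{z. (z, x) \<in> Q\<^sup>+} \<subset> {z. (z, y) \<in> Q\<^sup>+}"
    using xy ac by (auto simp: acyclic_def)
  ultimately show "card {z. (z, x) \<in> Q\<^sup>+} < card {z. (z, y) \<in> Q\<^sup>+}"
    by (rule psubset_card_mono)
qed

text \<open>A numbering of \<open>Q\<close> is adapted to the flipped quiver: a source, now a sink,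
  gets a number above all others, and a sink, now a source, gets 0 after all other numbers are
  raised by one.\<close>

lemma quiver_flip_at:
  assumes Q: "quiver n Q" and k: "is_source n Q k \<or> is_sink n Q k"
  shows "quiver n (flip_at k Q)"
proof -
  obtain g :: "nat \<Rightarrow> nat" where g: "\<And>x y. (x, y) \<in> Q \<Longrightarrow> g x < g y"
    using quiver_numbering[OF Q] by blast
  have sub: "Q \<subseteq> {1..n} \<times> {1..n}" using Q by (auto simp: quiver_def)
  have le: "g x < Suc (sum g {1..n})" if "x \<in> {1..n}" for x
    using that by (intro le_imp_less_Suc member_le_sum) auto
  have "acyclic (flip_at k Q)"
  proof (cases "is_source n Q k")
    case True
    then show ?thesis
      using sub
      by (intro acyclic_if_numbering[where g = "g(k := Suc (sum g {1..n}))"])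
         (auto simp: flip_at_def is_source_def g simp del: One_nat_def intro!: le split: if_splits)
  next
    case False
    then show ?thesis
      using k
      by (intro acyclic_if_numbering[where g = "(Suc \<circ> g)(k := 0)"])
         (auto simp: flip_at_def is_sink_def g split: if_splits)
  qed
  then show ?thesis using sub by (auto simp: quiver_def flip_at_def split: if_splits)
qed

lemma flip_at_flip_at: "flip_at k (flip_at k Q) = Q"
  by (auto simp: flip_at_def)

text \<open>A flip is an involution that exchanges sources and sinks, so it is undone by flipping
  the same vertex again.\<close>

lemma sym_flip_rel: "sym (flip_rel n)"
proof (rule symI)
  fix Q R assume "(Q, R) \<in> flip_rel n"
  then obtain k where Q: "quiver n Q" and k: "is_source n Q k \<or> is_sink n Q k"
    and R: "R = flip_at k Q" by (auto simp: flip_rel_def)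
  have "is_source n R k \<or> is_sink n R k"
    using k by (auto simp: R is_source_def is_sink_def flip_at_def)
  then show "(R, Q) \<in> flip_rel n"
    using quiver_flip_at[OF Q k] by (auto simp: flip_rel_def R flip_at_flip_at intro!: exI)
qed

lemma toric_class_eqI:
  assumes "R \<in> toric_class n Q"
  shows "toric_class n R = toric_class n Q"
  using assms sym_rtrancl[OF sym_flip_rel, of n]
  by (auto simp: toric_class_def dest: symD intro: rtrancl_trans)

lemma self_in_toric_class: "Q \<in> toric_class n Q"
  by (simp add: toric_class_def)

lemma quiver_toric_class:
  assumes "quiver n Q" "R \<in> toric_class n Q"
  shows "quiver n R"
  using assms(2) unfolding toric_class_def mem_Collect_eq
  by induction (auto simp: assms(1) flip_rel_def quiver_flip_at)

section \<open>Toric classes as tilts by a potential\<close>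

definition admissible :: "(nat \<Rightarrow> int) \<Rightarrow> (nat \<times> nat) set \<Rightarrow> bool" where
  "admissible f Q \<longleftrightarrow> (\<forall>x y. (x, y) \<in> Q \<longrightarrow> f y = f x \<or> f y = f x + 1)"

definition tilt :: "(nat \<Rightarrow> int) \<Rightarrow> (nat \<times> nat) set \<Rightarrow> (nat \<times> nat) set" where
  "tilt f Q = {(x, y). (x, y) \<in> Q \<and> f x = f y \<or> (y, x) \<in> Q \<and> f x = f y + 1}"

text \<open>Induction along the flips: the potential changes only at the flipped vertex, by -1 at a
  source and by +1 at a sink.\<close>

lemma tilt_of_toric_class:
  assumes Q: "quiver n Q" and R: "R \<in> toric_class n Q"
  shows "\<exists>f. admissible f Q \<and> R = tilt f Q"
  using R unfolding toric_class_def mem_Collect_eq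
proof induction
  case base
  show ?case by (rule exI[of _ "\<lambda>_. 0"]) (auto simp: admissible_def tilt_def)
next
  case (step R S)
  then obtain f where f: "admissible f Q" "R = tilt f Q" by blast
  from step obtain k where k: "is_source n R k \<or> is_sink n R k" and S: "S = flip_at k R"
    and qR: "quiver n R"
    by (auto simp: flip_rel_def)
  have irr: "(x, x) \<notin> Q" for x using Q by (auto simp: quiver_def acyclic_def)
  have src: ?case if "is_source n R k"
  proof (intro exI conjI)
    let ?f = "f(k := f k - 1)"
    from that have nk: "(x, k) \<notin> tilt f Q" for x by (simp add: is_source_def f)
    \<comment> \<open>For \<open>k\<close> to be a source of the tilt, the arcs of \<open>Q\<close>
      out of \<open>k\<close> must have been kept and those into \<open>k\<close> reversed. Lowering
      \<open>f k\<close> by one exchanges the two cases.\<close>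
    have out: "f y = f k" if "(k, y) \<in> Q" for y
      using nk[of y] that f(1) by (fastforce simp: admissible_def tilt_def)
    have inn: "f k = f y + 1" if "(y, k) \<in> Q" for y
      using nk[of y] that f(1) by (fastforce simp: admissible_def tilt_def)
    show "admissible ?f Q"
      using f(1) irr by (auto simp: admissible_def dest: out inn)
    show "S = tilt ?f Q"
      using irr by (auto simp: S f(2) flip_at_def tilt_def fun_upd_def dest: out inn split: if_splits)
  qed
  have snk: ?case if "is_sink n R k"
  proof (intro exI conjI)
    let ?f = "f(k := f k + 1)"
    from that have nk: "(k, x) \<notin> tilt f Q" for x by (simp add: is_sink_def f)
    have out: "f y = f k + 1" if "(k, y) \<in> Q" for y
      using nk[of y] that f(1) by (fastforce simp: admissible_def tilt_def)
    have inn: "f k = f y" if "(y, k) \<in> Q" for y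
      using nk[of y] that f(1) by (fastforce simp: admissible_def tilt_def)
    show "admissible ?f Q"
      using f(1) irr by (auto simp: admissible_def dest: out inn)
    show "S = tilt ?f Q"
      using irr by (auto simp: S f(2) flip_at_def tilt_def fun_upd_def dest: out inn split: if_splits)
  qed
  from src snk k show ?case by blast
qed

text \<open>Induction on the total depth of \<open>f\<close> below zero. A flip of \<open>Q\<close>
  at a suitable source is absorbed by raising \<open>f\<close> there, which leaves the tilt fixed;
  at depth zero the tilt is \<open>Q\<close> itself.\<close>

lemma tilt_nonpos_in_toric_class:
  assumes "quiver n Q" "admissible f Q" "\<And>x. x \<in> {1..n} \<Longrightarrow> f x \<le> 0"
  shows "tilt f Q \<in> toric_class n Q"
  using assms
proof (induction "\<Sum>x\<in>{1..n}. nat (- f x)" arbitrary: f Q rule: less_induct)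
  case less
  have sub: "Q \<subseteq> {1..n} \<times> {1..n}" and ac: "acyclic Q"
    using less.prems(1) by (auto simp: quiver_def)
  then have "wf Q" by (intro finite_acyclic_wf) (auto intro: finite_subset)
  show ?case
  proof (cases "\<exists>x\<in>{1..n}. f x < 0")
    case False
    with less.prems(3) have "f x = 0" if "x \<in> {1..n}" for x using that by force
    then have "tilt f Q = Q"
      using sub by (auto simp: tilt_def; force)
    then show ?thesis by (simp add: self_in_toric_class)
  next
    case True
    \<comment> \<open>No arc enters the minimum set of \<open>f\<close>, so it contains a source \<open>k\<close>; flip it and raise \<open>f k\<close>.\<close>
    define m where "m = Min (f ` {1..n})"
    have m_le: "m \<le> f x" if "x \<in> {1..n}" for x using that by (auto simp: m_def)
    have "m < 0" using True m_le by force
    have "m \<in> f ` {1..n}" unfolding m_def using True by (intro Min_in) auto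
    then obtain z where z: "z \<in> {x \<in> {1..n}. f x = m}" by auto
    obtain k where k: "k \<in> {1..n}" "f k = m"
      and k_min: "\<And>y. (y, k) \<in> Q \<Longrightarrow> \<not> (y \<in> {1..n} \<and> f y = m)"
      by (rule wfE_min[OF \<open>wf Q\<close> z]) blast
    have no_in: "(y, k) \<notin> Q" for y
    proof
      assume yk: "(y, k) \<in> Q"
      then have "y \<in> {1..n}" using sub by auto
      moreover from this have "f y = m"
        using yk less.prems(2)[unfolded admissible_def, rule_format, OF yk] m_le[of y] k(2) by simp
      ultimately show False using k_min[OF yk] by blast
    qed
    then have src: "is_source n Q k" using k by (simp add: is_source_def)
    let ?f = "f(k := f k + 1)" and ?Q = "flip_at k Q"
    have out: "f y = f k \<or> f y = f k + 1" if "(k, y) \<in> Q" for y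
      using that less.prems(2) by (auto simp: admissible_def)
    have "tilt ?f ?Q \<in> toric_class n ?Q"
    proof (rule less.hyps)
      show "(\<Sum>x\<in>{1..n}. nat (- ?f x)) < (\<Sum>x\<in>{1..n}. nat (- f x))"
        by (rule sum_strict_mono_ex1) (use k \<open>m < 0\<close> in auto)
      show "quiver n ?Q" using quiver_flip_at less.prems(1) src by blast
      show "admissible ?f ?Q"
        using less.prems(2) no_in by (auto simp: admissible_def flip_at_def dest: out)
      show "?f x \<le> 0" if "x \<in> {1..n}" for x
        using less.prems(3)[OF that] k \<open>m < 0\<close> by auto
    qed
    \<comment> \<open>An arc at \<open>k\<close> that was constant for \<open>f\<close> rises after
      the flip, and one that rose becomes constant; reversing twice or not at all gives the same
      orientation.\<close>
    moreover have "tilt ?f ?Q = tilt f Q"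
      using no_in by (auto simp: tilt_def flip_at_def dest: out split: if_splits)
    moreover have "toric_class n ?Q = toric_class n Q"
      using less.prems(1) src
      by (intro toric_class_eqI) (auto simp: toric_class_def flip_rel_def intro!: r_into_rtrancl)
    ultimately show ?thesis by simp
  qed
qed

lemma toric_class_eq_tilts:
  assumes "quiver n Q"
  shows "toric_class n Q = {tilt f Q |f. admissible f Q}"
proof -
  have "tilt f Q \<in> toric_class n Q" if "admissible f Q" for f
  proof -
    \<comment> \<open>Subtracting a constant changes neither the tilt nor admissibility and brings
      the potential below zero. The inserted 0 keeps the maximum meaningful for
      \<open>n = 0\<close>.\<close>
    define g where "g x = f x - Max (insert 0 (f ` {1..n}))" for x
    have "tilt g Q = tilt f Q" "admissible g Q"
      using that by (auto simp: tilt_def admissible_def g_def)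
    moreover have "g x \<le> 0" if "x \<in> {1..n}" for x
      using Max_ge[of "insert 0 (f ` {1..n})" "f x"] that by (simp add: g_def del: Max_insert)
    ultimately show ?thesis using tilt_nonpos_in_toric_class[OF assms, of g] by simp
  qed
  then show ?thesis using tilt_of_toric_class[OF assms] by blast
qed

lemma class_graph_toric_class:
  assumes "quiver n Q"
  shows "class_graph (toric_class n Q) = {{i, j} |i j. (i, j) \<in> Q}"
proof -
  have "\<exists>k l. {i, j} = {k, l} \<and> (k, l) \<in> Q" if "R \<in> toric_class n Q" "(i, j) \<in> R" for R i j
    using that tilt_of_toric_class[OF assms that(1)] by (auto simp: tilt_def)
  moreover have "{i, j} \<in> class_graph (toric_class n Q)" if "(i, j) \<in> Q" for i j
    using that self_in_toric_class unfolding class_graph_def by blast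
  ultimately show ?thesis by (fastforce simp: class_graph_def)
qed

lemma adj_rel_toric_class:
  assumes "quiver n Q"
  shows "adj_rel (class_graph (toric_class n Q)) = Q \<union> Q\<inverse>"
  unfolding class_graph_toric_class[OF assms] by (auto simp: adj_rel_def doubleton_eq_iff)

section \<open>Chambers and lifts\<close>

definition toric_lift :: "(nat \<times> nat) set \<Rightarrow> (nat \<Rightarrow> real) \<Rightarrow> bool" where
  "toric_lift Q X \<longleftrightarrow> (\<forall>x y. (x, y) \<in> Q \<longrightarrow> X x < X y \<and> X y < X x + 1)"

definition liftable :: "(nat \<Rightarrow> real) \<Rightarrow> (nat \<times> nat) set \<Rightarrow> bool" where
  "liftable c Q \<longleftrightarrow> (\<exists>f :: nat \<Rightarrow> int. toric_lift Q (\<lambda>x. c x + of_int (f x)))"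

lemma toric_lift_subset: "toric_lift R X \<Longrightarrow> Q \<subseteq> R \<Longrightarrow> toric_lift Q X"
  by (auto simp: toric_lift_def)

lemma liftable_subset: "liftable c R \<Longrightarrow> Q \<subseteq> R \<Longrightarrow> liftable c Q"
  by (auto simp: liftable_def intro: toric_lift_subset)

lemma toric_lift_insert:
  "toric_lift (insert (a, b) Q) X \<longleftrightarrow> X a < X b \<and> X b < X a + 1 \<and> toric_lift Q X"
  by (auto simp: toric_lift_def)

lemma liftable_acyclic: "liftable c Q \<Longrightarrow> acyclic Q"
  unfolding liftable_def toric_lift_def
  by (elim exE, rule_tac g = "\<lambda>x. c x + real_of_int (f x)" in acyclic_if_numbering) blast

text \<open>This translates between real lifts and integer potentials: a gap in the open unit
  interval means either equal integer parts and increasing fractional parts, or one integer step and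
  decreasing fractional parts.\<close>

lemma unit_gap_iff:
  fixes c d :: real and f g :: int
  assumes "0 \<le> c" "c < 1" "0 \<le> d" "d < 1"
  shows "c + f < d + g \<and> d + g < c + f + 1 \<longleftrightarrow> g = f \<and> c < d \<or> g = f + 1 \<and> d < c"
proof
  assume *: "c + f < d + g \<and> d + g < c + f + 1"
  then have "real_of_int f < of_int (g + 1)" "real_of_int g < of_int (f + 2)" using assms by auto
  then have "g = f \<or> g = f + 1" by linarith
  with * show "g = f \<and> c < d \<or> g = f + 1 \<and> d < c" by auto
qed (use assms in auto)

section \<open>Coordinates modulo 1 and the chamber of a toric poset\<close>

lemma frac_int_cong:
  assumes "x \<in> Rn n" "i \<in> {1..n}" "y \<in> int_cong n `` {x}"
  shows "frac (y i) = frac (x i)"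
proof -
  have "x i - y i \<in> \<int>" using assms by (auto simp: int_cong_def)
  then obtain k where "x i = y i + of_int k" by (metis Ints_cases add.commute diff_add_cancel)
  then show ?thesis by (simp add: frac_def)
qed

lemma coord_mod1_class:
  assumes "x \<in> Rn n" "i \<in> {1..n}"
  shows "coord_mod1 (int_cong n `` {x}) i = frac (x i)"
proof -
  have "(\<lambda>y. frac (y i)) ` (int_cong n `` {x}) = (\<lambda>_. frac (x i)) ` (int_cong n `` {x})"
    by (rule image_cong[OF refl]) (rule frac_int_cong[OF assms])
  moreover have "x \<in> int_cong n `` {x}" using assms by (auto simp: int_cong_def)
  ultimately have "(\<lambda>y. frac (y i)) ` (int_cong n `` {x}) = {frac (x i)}" by auto
  then show ?thesis by (simp add: coord_mod1_def)
qed

lemma coord_mod1_range: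
  assumes "p \<in> torus n" "i \<in> {1..n}"
  shows "0 \<le> coord_mod1 p i" "coord_mod1 p i < 1"
  using assms by (auto simp: torus_def quotient_def coord_mod1_class frac_lt_1
      simp del: atLeastAtMost_iff)

text \<open>The same function \<open>f\<close> serves on both sides: as the potential that tilts
  \<open>Q\<close> to the orientation of the point, and as the integer part of the lift.\<close>

lemma toric_chamber_iff_liftable:
  assumes Q: "quiver n Q"
  shows "p \<in> toric_chamber n (toric_class n Q) \<longleftrightarrow> p \<in> torus n \<and> liftable (coord_mod1 p) Q"
proof (cases "p \<in> torus n")
  case False
  then show ?thesis by (simp add: toric_chamber_def)
next
  case True
  let ?c = "coord_mod1 p" and ?G = "class_graph (toric_class n Q)"
  have sub: "Q \<subseteq> {1..n} \<times> {1..n}" using Q by (auto simp: quiver_def)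
  have G: "{x, y} \<in> ?G \<longleftrightarrow> (x, y) \<in> Q \<or> (y, x) \<in> Q" for x y
    using adj_rel_toric_class[OF Q] by (auto simp: adj_rel_def)
  have lift: "toric_lift Q (\<lambda>x. ?c x + of_int (f x)) \<longleftrightarrow>
      (\<forall>x y. (x, y) \<in> Q \<longrightarrow> f y = f x \<and> ?c x < ?c y \<or> f y = f x + 1 \<and> ?c y < ?c x)" for f
  proof -
    have "?c x + f x < ?c y + f y \<and> ?c y + f y < ?c x + f x + 1 \<longleftrightarrow>
        f y = f x \<and> ?c x < ?c y \<or> f y = f x + 1 \<and> ?c y < ?c x" if "(x, y) \<in> Q" for x y
      using sub that by (intro unit_gap_iff coord_mod1_range[OF True]) auto
    then show ?thesis by (auto simp: toric_lift_def)
  qed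
  have or: "point_orientation ?G p = {(x, y). ((x, y) \<in> Q \<or> (y, x) \<in> Q) \<and> ?c x < ?c y}"
    by (simp add: point_orientation_def G)
  show ?thesis
  proof
    assume "p \<in> toric_chamber n (toric_class n Q)"
    then obtain f where f: "admissible f Q" and R: "point_orientation ?G p = tilt f Q"
      by (auto simp: toric_chamber_def toric_class_eq_tilts[OF Q])
    have "f y = f x \<and> ?c x < ?c y \<or> f y = f x + 1 \<and> ?c y < ?c x" if "(x, y) \<in> Q" for x y
    proof (cases "f y = f x")
      case True
      then have "(x, y) \<in> tilt f Q" using that by (simp add: tilt_def)
      with True show ?thesis by (simp flip: R add: or)
    next
      case False
      then have *: "f y = f x + 1" using f that by (auto simp: admissible_def)
      then have "(y, x) \<in> tilt f Q" using that by (simp add: tilt_def)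
      with * show ?thesis by (simp flip: R add: or)
    qed
    then show "p \<in> torus n \<and> liftable ?c Q" using True lift by (auto simp: liftable_def)
  next
    assume "p \<in> torus n \<and> liftable ?c Q"
    then obtain f where "toric_lift Q (\<lambda>x. ?c x + of_int (f x))" by (auto simp: liftable_def)
    then have f: "f y = f x \<and> ?c x < ?c y \<or> f y = f x + 1 \<and> ?c y < ?c x" if "(x, y) \<in> Q" for x y
      using lift that by blast
    have "admissible f Q" using f by (auto simp: admissible_def)
    moreover have "point_orientation ?G p = tilt f Q"
    proof -
      have "(x, y) \<in> Q \<and> f x = f y \<or> (y, x) \<in> Q \<and> f x = f y + 1 \<longleftrightarrow>
          ((x, y) \<in> Q \<or> (y, x) \<in> Q) \<and> ?c x < ?c y" for x y
        using f[of x y] f[of y x] by auto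
      then show ?thesis unfolding or tilt_def by auto
    qed
    ultimately have "point_orientation ?G p \<in> toric_class n Q"
      by (auto simp: toric_class_eq_tilts[OF Q])
    \<comment> \<open>On the arrangement the ends of some edge would have equal coordinates modulo
      1, whereas a lift makes one of them strictly smaller.\<close>
    moreover have "p \<notin> toric_arrangement n ?G"
    proof
      assume "p \<in> toric_arrangement n ?G"
      then obtain x i j where x: "x \<in> Rn n" "x i = x j" "{i, j} \<in> ?G" "p = int_cong n `` {x}"
        by (auto simp: toric_arrangement_def adj_rel_def)
      then have "i \<in> {1..n}" "j \<in> {1..n}" using sub by (auto simp: G)
      with x have "?c i = ?c j" by (simp add: coord_mod1_class del: atLeastAtMost_iff)
      with x(3) f[of i j] f[of j i] show False by (auto simp: G)
    qed
    ultimately show "p \<in> toric_chamber n (toric_class n Q)"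
      using True by (simp add: toric_chamber_def)
  qed
qed

section \<open>Lifts of cyclic orders\<close>

lemma precedes_in_Cons:
  "precedes_in (h # t) x y \<longleftrightarrow> x = h \<and> y \<in> set t \<or> precedes_in t x y"
proof
  assume "precedes_in (h # t) x y"
  then obtain k l where "k < l" "l < length (h # t)" "(h # t) ! k = x" "(h # t) ! l = y"
    by (auto simp: precedes_in_def)
  then show "x = h \<and> y \<in> set t \<or> precedes_in t x y"
    by (cases k; cases l) (auto simp: precedes_in_def)
next
  assume "x = h \<and> y \<in> set t \<or> precedes_in t x y"
  then show "precedes_in (h # t) x y"
  proof
    assume "x = h \<and> y \<in> set t"
    then obtain l where "l < length t" "t ! l = y" "x = h" by (auto simp: in_set_conv_nth)
    then show ?thesis unfolding precedes_in_def by (intro exI[of _ 0] exI[of _ "Suc l"]) auto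
  next
    assume "precedes_in t x y"
    then obtain k l where "k < l" "l < length t" "t ! k = x" "t ! l = y"
      by (auto simp: precedes_in_def)
    then show ?thesis unfolding precedes_in_def by (intro exI[of _ "Suc k"] exI[of _ "Suc l"]) auto
  qed
qed

lemma precedes_in_Nil: "\<not> precedes_in [] x y"
  by (simp add: precedes_in_def)

lemma precedes_in_snoc:
  "precedes_in (t @ [h]) x y \<longleftrightarrow> y = h \<and> x \<in> set t \<or> precedes_in t x y"
  by (induction t) (auto simp: precedes_in_Cons precedes_in_Nil)

lemma precedes_in_set: "precedes_in w x y \<Longrightarrow> x \<in> set w \<and> y \<in> set w"
  by (auto simp: precedes_in_def)

lemma precedes_in_sort_key:
  fixes c :: "'a \<Rightarrow> 'b::linorder"
  assumes "inj_on c (set xs)" "distinct xs" "x \<in> set xs" "y \<in> set xs"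
  shows "precedes_in (sort_key c xs) x y \<longleftrightarrow> c x < c y"
proof
  let ?s = "sort_key c xs"
  have mono: "c (?s ! k) \<le> c (?s ! l)" if "k \<le> l" "l < length ?s" for k l
    using sorted_nth_mono[OF sorted_sort_key[of c xs], of k l] that by simp
  {
    assume "precedes_in ?s x y"
    then obtain k l where kl: "k < l" "l < length ?s" "?s ! k = x" "?s ! l = y"
      by (auto simp: precedes_in_def)
    have "distinct ?s" using assms(2) by simp
    then have "x \<noteq> y" using kl by (metis nth_eq_iff_index_eq order_less_trans less_irrefl)
    then have "c x \<noteq> c y" using assms by (auto dest: inj_onD)
    with mono[of k l] kl show "c x < c y" by simp
  next
    assume xy: "c x < c y"
    have "x \<in> set ?s" "y \<in> set ?s" using assms by auto
    then obtain k l where kl: "k < length ?s" "l < length ?s" "?s ! k = x" "?s ! l = y"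
      by (metis in_set_conv_nth)
    with mono[of l k] xy have "k < l" by (metis linorder_not_less)
    with kl show "precedes_in ?s x y" by (auto simp: precedes_in_def)
  }
qed

text \<open>The combinatorial form of a lift: \<open>w\<close> records the order of the fractional
  parts and \<open>f\<close> the integer parts.\<close>

definition list_liftable :: "nat list \<Rightarrow> (nat \<times> nat) set \<Rightarrow> bool" where
  "list_liftable w Q \<longleftrightarrow> (\<exists>f :: nat \<Rightarrow> int. \<forall>x y. (x, y) \<in> Q \<longrightarrow>
     f y = f x \<and> precedes_in w x y \<or> f y = f x + 1 \<and> precedes_in w y x)"

lemma list_liftable_rotate1:
  assumes "distinct w" "list_liftable w Q"
  shows "list_liftable (rotate1 w) Q"
proof (cases w)
  case (Cons h t)
  obtain f :: "nat \<Rightarrow> int" where f: "\<And>x y. (x, y) \<in> Q \<Longrightarrow>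
     f y = f x \<and> precedes_in w x y \<or> f y = f x + 1 \<and> precedes_in w y x"
    using assms(2) by (auto simp: list_liftable_def)
  have "h \<notin> set t" using assms(1) Cons by simp
  \<comment> \<open>Moving the head to the end lets its fractional part drop through 0 and reappear
    just below 1, so its integer part falls by one.\<close>
  let ?f = "f(h := f h - 1)"
  have "?f y = ?f x \<and> precedes_in (t @ [h]) x y \<or> ?f y = ?f x + 1 \<and> precedes_in (t @ [h]) y x"
    if "(x, y) \<in> Q" for x y
    using f[OF that] \<open>h \<notin> set t\<close> precedes_in_set[of t x y] precedes_in_set[of t y x]
    by (auto simp: precedes_in_snoc precedes_in_Cons Cons)
  then show ?thesis
    unfolding list_liftable_def Cons rotate1.simps by blast
qed (use assms in simp)

lemma list_liftable_rotate:
  assumes "distinct w" "list_liftable w Q"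
  shows "list_liftable (rotate k w) Q"
  by (induction k) (simp_all add: assms list_liftable_rotate1)

lemma list_liftable_rotation_class:
  assumes "distinct w" "u \<in> rotation_class w" "v \<in> rotation_class w" "list_liftable u Q"
  shows "list_liftable v Q"
proof -
  obtain k l where kl: "u = rotate k w" "v = rotate l w"
    using assms by (auto simp: rotation_class_def)
  \<comment> \<open>The complementary rotation leads from \<open>u\<close> back to \<open>w\<close>,
    from where a further rotation leads to \<open>v\<close>.\<close>
  have "w = rotate (length w - k mod length w) (rotate k w)"
  proof (cases "w = []")
    case False
    then have "k mod length w < length w" by simp
    then show ?thesis
      using rotate_conv_mod[of k w] rotate_rotate[of "length w - k mod length w" "k mod length w" w]
      by simp
  qed simp
  with list_liftable_rotate[of u Q "length w - k mod length w"] assms kl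
  have "list_liftable w Q" by simp
  then show ?thesis using assms(1) kl by (simp add: list_liftable_rotate)
qed

section \<open>From torus points to cyclic orders and toric total extensions\<close>

lemma liftable_iff_list_liftable:
  assumes "p \<in> torus n" "inj_on (coord_mod1 p) {1..n}" "Q \<subseteq> {1..n} \<times> {1..n}"
  shows "liftable (coord_mod1 p) Q \<longleftrightarrow> list_liftable (sort_key (coord_mod1 p) [1..<n+1]) Q"
proof -
  let ?c = "coord_mod1 p"
  have set: "set [1..<n+1] = {1..n}" by auto
  have prec: "precedes_in (sort_key ?c [1..<n+1]) x y \<longleftrightarrow> ?c x < ?c y"
    if "x \<in> {1..n}" "y \<in> {1..n}" for x y
    using that assms(2) by (intro precedes_in_sort_key) (auto simp only: set distinct_upt)
  have "?c x + f x < ?c y + f y \<and> ?c y + f y < ?c x + f x + 1 \<longleftrightarrow>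
      f y = f x \<and> precedes_in (sort_key ?c [1..<n+1]) x y \<or>
      f y = f x + 1 \<and> precedes_in (sort_key ?c [1..<n+1]) y x"
    if "(x, y) \<in> Q" for x y and f :: "nat \<Rightarrow> int"
  proof -
    have xy: "x \<in> {1..n}" "y \<in> {1..n}" using that assms(3) by auto
    show ?thesis
      unfolding prec[OF xy] prec[OF xy(2,1)]
      by (intro unit_gap_iff coord_mod1_range[OF assms(1)] xy)
  qed
  then show ?thesis unfolding liftable_def toric_lift_def list_liftable_def by meson
qed

text \<open>Sorted lists of two points of the chamber are rotations of each other. Inclusion of the
  chamber can therefore be tested at a single point.\<close>

lemma liftable_total_order_chamber:
  assumes "W \<in> toric_total_orders n" "Q \<subseteq> {1..n} \<times> {1..n}"
    and "p \<in> total_order_chamber n W" "q \<in> total_order_chamber n W" "liftable (coord_mod1 p) Q"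
  shows "liftable (coord_mod1 q) Q"
proof -
  obtain w where w: "w \<in> permutations_of_set {1..n}" "W = rotation_class w"
    using assms(1) by (auto simp: toric_total_orders_def)
  have dist: "distinct w" using w(1) by (simp add: permutations_of_set_def)
  let ?s = "\<lambda>p. sort_key (coord_mod1 p) [1..<n+1]"
  have p: "p \<in> torus n" "inj_on (coord_mod1 p) {1..n}" "?s p \<in> rotation_class w"
    and q: "q \<in> torus n" "inj_on (coord_mod1 q) {1..n}" "?s q \<in> rotation_class w"
    using assms(3,4) by (simp_all only: total_order_chamber_def w(2) mem_Collect_eq)
  have "list_liftable (?s p) Q"
    using assms(5) liftable_iff_list_liftable[OF p(1,2) assms(2)] by blast
  then have "list_liftable (?s q) Q" by (rule list_liftable_rotation_class[OF dist p(3) q(3)])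
  then show ?thesis using liftable_iff_list_liftable[OF q(1,2) assms(2)] by blast
qed

lemma total_order_chamber_point:
  assumes "w \<in> permutations_of_set {1..n}"
  obtains p where "p \<in> torus n" "inj_on (coord_mod1 p) {1..n}"
    "sort_key (coord_mod1 p) [1..<n+1] = w"
proof -
  have w: "set w = {1..n}" "distinct w" using assms by (auto simp: permutations_of_set_def)
  then have len: "length w = n" by (metis card_atLeastAtMost diff_Suc_1 distinct_card)
  have bij: "bij_betw (nth w) {..<n} {1..n}"
    using bij_betw_nth[of w "{..<n}" "{1..n}"] w len by auto
  \<comment> \<open>The entry at position \<open>k\<close> of \<open>w\<close>, counted from 0, gets
    the coordinate \<open>k / n\<close>, so all coordinates lie in [0,1) and increase along
    \<open>w\<close>.\<close>
  define x where "x = restrict (\<lambda>i. real (inv_into {..<n} (nth w) i) / n) {1..n}"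
  have x: "x (w ! k) = real k / n" if "k < n" for k
    using that bij bij_betw_inv_into_left[OF bij, of k] w(1) len nth_mem[of k w] by (auto simp: x_def)
  have xR: "x \<in> Rn n" by (simp add: Rn_def x_def)
  define p where "p = int_cong n `` {x}"
  have c: "coord_mod1 p (w ! k) = real k / n" if "k < n" for k
  proof -
    have "coord_mod1 p (w ! k) = frac (x (w ! k))"
      unfolding p_def using xR w(1) len that nth_mem[of k w] by (intro coord_mod1_class) auto
    also have "\<dots> = real k / n" using that by (simp add: x frac_eq)
    finally show ?thesis .
  qed
  have inj: "inj_on (coord_mod1 p) {1..n}"
  proof (rule inj_onI)
    fix i j assume ij: "i \<in> {1..n}" "j \<in> {1..n}" "coord_mod1 p i = coord_mod1 p j"
    then obtain k l where "k < n" "l < n" "i = w ! k" "j = w ! l"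
      using w(1) len by (metis in_set_conv_nth)
    with ij show "i = j" by (simp add: c)
  qed
  show thesis
  proof
    show "p \<in> torus n" using xR by (auto simp: p_def torus_def intro: quotientI)
    show "inj_on (coord_mod1 p) {1..n}" by (rule inj)
    have set: "set [1..<n+1] = {1..n}" by auto
    show "sort_key (coord_mod1 p) [1..<n+1] = w"
    proof (rule sort_key_inj_key_eq)
      show "mset [1..<n+1] = mset w" using w set by (metis set_eq_iff_mset_eq_distinct distinct_upt)
      show "inj_on (coord_mod1 p) (set [1..<n+1])" using inj set by simp
      show "sorted (map (coord_mod1 p) w)"
        using len by (auto simp: sorted_iff_nth_mono c divide_right_mono)
    qed
  qed
qed

text \<open>This excludes that an inclusion of chambers holds vacuously.\<close>

lemma total_order_chamber_nonempty:
  assumes "W \<in> toric_total_orders n"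
  shows "total_order_chamber n W \<noteq> {}"
proof -
  obtain w where w: "w \<in> permutations_of_set {1..n}" "W = rotation_class w"
    using assms by (auto simp: toric_total_orders_def)
  obtain p where "p \<in> torus n" "inj_on (coord_mod1 p) {1..n}"
    "sort_key (coord_mod1 p) [1..<n+1] = rotate 0 w"
    using total_order_chamber_point[OF w(1)] by (metis rotate0 id_apply)
  then have "p \<in> total_order_chamber n W"
    unfolding total_order_chamber_def w(2) rotation_class_def by blast
  then show ?thesis by blast
qed

text \<open>If \<open>Q\<close> has a directed cycle, no flip applies and the class is \<open>{Q}\<close>, which is no orientation
  induced by a point; hence acyclicity need not be assumed.\<close>

lemma toric_extensions_iff:
  assumes sub: "Q \<subseteq> {1..n} \<times> {1..n}"
  shows "W \<in> toric_extensions n (toric_class n Q) \<longleftrightarrow>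
    W \<in> toric_total_orders n \<and> (\<exists>p\<in>total_order_chamber n W. liftable (coord_mod1 p) Q)"
proof (cases "acyclic Q")
  case True
  then have Q: "quiver n Q" using sub by (simp add: quiver_def)
  have "total_order_chamber n W \<subseteq> toric_chamber n (toric_class n Q) \<longleftrightarrow>
      (\<forall>p\<in>total_order_chamber n W. liftable (coord_mod1 p) Q)"
    unfolding subset_iff toric_chamber_iff_liftable[OF Q] total_order_chamber_def by blast
  then show ?thesis
    unfolding toric_extensions_def mem_Collect_eq
    using total_order_chamber_nonempty[of W n] liftable_total_order_chamber[OF _ sub, of W] by blast
next
  case False
  then have no_flip: "(Q, R) \<notin> flip_rel n" for R by (auto simp: flip_rel_def quiver_def)
  have "R = Q" if "R \<in> toric_class n Q" for R
    using that no_flip unfolding toric_class_def mem_Collect_eq by (blast elim: converse_rtranclE)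
  moreover have "acyclic (point_orientation G p)" for G p
    by (rule acyclic_if_numbering[where g = "coord_mod1 p"]) (simp add: point_orientation_def)
  ultimately have "toric_chamber n (toric_class n Q) = {}"
    using False unfolding toric_chamber_def by fastforce
  then show ?thesis
    using False total_order_chamber_nonempty[of W n] liftable_acyclic
    unfolding toric_extensions_def by blast
qed

section \<open>Adding an arc\<close>

text \<open>A finite test for an explicit list, used for the example with a proper
  inclusion.\<close>

lemma toric_extensions_rotation_class_iff:
  assumes w: "w \<in> permutations_of_set {1..n}" and sub: "Q \<subseteq> {1..n} \<times> {1..n}"
  shows "rotation_class w \<in> toric_extensions n (toric_class n Q) \<longleftrightarrow> list_liftable w Q"
proof -
  obtain p where p: "p \<in> torus n" "inj_on (coord_mod1 p) {1..n}"
    "sort_key (coord_mod1 p) [1..<n+1] = w"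
    using total_order_chamber_point[OF w] .
  have "sort_key (coord_mod1 p) [1..<n+1] = rotate 0 w" by (simp only: p rotate0 id_apply)
  then have ch: "p \<in> total_order_chamber n (rotation_class w)"
    using p(1,2) unfolding total_order_chamber_def rotation_class_def by blast
  have W: "rotation_class w \<in> toric_total_orders n"
    using w by (simp add: toric_total_orders_def)
  have "list_liftable w Q \<longleftrightarrow> liftable (coord_mod1 p) Q"
    using liftable_iff_list_liftable[OF p(1,2) sub] unfolding p(3) by blast
  then show ?thesis
    unfolding toric_extensions_iff[OF sub]
    using W ch liftable_total_order_chamber[OF W sub] by blast
qed

text \<open>Each further arc is a further constraint on the lift.\<close>

lemma toric_extensions_antimono:
  assumes "Q \<subseteq> R" "R \<subseteq> {1..n} \<times> {1..n}"
  shows "toric_extensions n (toric_class n R) \<subseteq> toric_extensions n (toric_class n Q)"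
proof
  fix W assume W: "W \<in> toric_extensions n (toric_class n R)"
  have "Q \<subseteq> {1..n} \<times> {1..n}" using assms by blast
  from toric_extensions_iff[OF this] W show "W \<in> toric_extensions n (toric_class n Q)"
    unfolding toric_extensions_iff[OF assms(2)] using liftable_subset[OF _ assms(1)] by blast
qed

lemma toric_extensions_disjoint:
  assumes sub: "Q \<subseteq> {1..n} \<times> {1..n}" and ab: "a \<in> {1..n}" "b \<in> {1..n}"
    and conn: "(a, b) \<in> (Q \<union> Q\<inverse>)\<^sup>*"
  shows "toric_extensions n (toric_class n (insert (a, b) Q)) \<inter>
    toric_extensions n (toric_class n (insert (b, a) Q)) = {}"
proof (rule ccontr)
  have sub1: "insert (a, b) Q \<subseteq> {1..n} \<times> {1..n}" and sub2: "insert (b, a) Q \<subseteq> {1..n} \<times> {1..n}"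
    using sub ab by auto
  assume "\<not> ?thesis"
  then obtain W where "W \<in> toric_extensions n (toric_class n (insert (a, b) Q))"
    "W \<in> toric_extensions n (toric_class n (insert (b, a) Q))" by blast
  then obtain p where "liftable (coord_mod1 p) (insert (a, b) Q)"
    "liftable (coord_mod1 p) (insert (b, a) Q)"
    unfolding toric_extensions_iff[OF sub1] toric_extensions_iff[OF sub2]
    using liftable_total_order_chamber[OF _ sub2] by blast
  then obtain f g :: "nat \<Rightarrow> int" and c :: "nat \<Rightarrow> real" where
    f: "toric_lift (insert (a, b) Q) (\<lambda>x. c x + f x)" and
    g: "toric_lift (insert (b, a) Q) (\<lambda>x. c x + g x)"
    unfolding liftable_def by blast
  \<comment> \<open>Two lifts of the same point differ by an integer function that is constant along arcs.\<close>
  have step: "f y - g y = f x - g x" if "(x, y) \<in> Q" for x y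
  proof -
    have "c x + f x < c y + f y" "c y + f y < c x + f x + 1"
      "c x + g x < c y + g y" "c y + g y < c x + g x + 1"
      using f g that unfolding toric_lift_insert by (auto simp: toric_lift_def)
    \<comment> \<open>Adding the upper bound from one lift to the lower bound from the other cancels
      \<open>c\<close>. Two integers, each less than the other plus one, are equal.\<close>
    then have "real_of_int (f y - g y) < of_int (f x - g x + 1)"
      "real_of_int (f x - g x) < of_int (f y - g y + 1)" by simp_all
    then show ?thesis unfolding of_int_less_iff by linarith
  qed
  from conn have "f b - g b = f a - g a"
    by induction (use step in fastforce)+
  then have "real_of_int (f b) - g b = f a - g a" by linarith
  then show False using f g unfolding toric_lift_insert by linarith
qed

lemma liftable_insert:
  assumes lift: "liftable c Q" and conn: "(a, b) \<notin> (Q \<union> Q\<inverse>)\<^sup>*" and "c a \<noteq> c b"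
    and "0 \<le> c a" "c a < 1" "0 \<le> c b" "c b < 1"
  shows "liftable c (insert (a, b) Q)"
proof -
  obtain f :: "nat \<Rightarrow> int" where f: "toric_lift Q (\<lambda>x. c x + f x)"
    using lift by (auto simp: liftable_def)
  define C where "C = {x. (a, x) \<in> (Q \<union> Q\<inverse>)\<^sup>*}"
  \<comment> \<open>Translating everything outside the component \<open>C\<close> of
    \<open>a\<close> by \<open>m\<close> gives \<open>b\<close> the integer part \<open>f a\<close>
    or \<open>f a + 1\<close>, whichever puts it less than one above \<open>a\<close>.\<close>
  define m where "m = f a - f b + (if c a < c b then 0 else 1)"
  define g where "g x = (if x \<in> C then f x else f x + m)" for x
  have "x \<in> C \<longleftrightarrow> y \<in> C" if "(x, y) \<in> Q" for x y
    using that by (auto simp: C_def intro: rtrancl.rtrancl_into_rtrancl)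
  then have "toric_lift Q (\<lambda>x. c x + g x)"
    using f by (auto simp: toric_lift_def g_def algebra_simps)
  moreover have "a \<in> C" "b \<notin> C" using conn by (simp_all add: C_def)
  ultimately have "toric_lift (insert (a, b) Q) (\<lambda>x. c x + g x)"
    using assms by (auto simp: toric_lift_insert g_def m_def)
  then show ?thesis unfolding liftable_def by blast
qed

text \<open>The potential that is 0 on the component of \<open>a\<close> and 1 elsewhere jumps only
  along the new arc, so tilting by it reverses exactly this arc.\<close>

lemma toric_class_insert_reverse:
  assumes Q: "quiver n Q" and ab: "a \<in> {1..n}" "b \<in> {1..n}" and conn: "(a, b) \<notin> (Q \<union> Q\<inverse>)\<^sup>*"
  shows "toric_class n (insert (a, b) Q) = toric_class n (insert (b, a) Q)"
proof -
  define C where "C = {x. (a, x) \<in> (Q \<union> Q\<inverse>)\<^sup>*}"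
  define f :: "nat \<Rightarrow> int" where "f x = (if x \<in> C then 0 else 1)" for x
  have const: "x \<in> C \<longleftrightarrow> y \<in> C" if "(x, y) \<in> Q" for x y
    using that by (auto simp: C_def intro: rtrancl.rtrancl_into_rtrancl)
  have aC: "a \<in> C" and bC: "b \<notin> C" using conn by (simp_all add: C_def)
  \<comment> \<open>Without a path back from \<open>b\<close> to \<open>a\<close> the new arc closes
    no cycle.\<close>
  have "(b, a) \<notin> Q\<^sup>*"
  proof
    assume "(b, a) \<in> Q\<^sup>*"
    then have "(a, b) \<in> (Q\<inverse>)\<^sup>*" by (simp add: rtrancl_converse)
    then show False using conn rtrancl_mono[of "Q\<inverse>" "Q \<union> Q\<inverse>"] by blast
  qed
  then have q: "quiver n (insert (a, b) Q)"
    using Q ab by (simp add: quiver_def acyclic_insert)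
  have fQ: "f x = f y" if "(x, y) \<in> Q" for x y using const[OF that] by (simp add: f_def)
  have fab: "f a = 0" "f b = 1" using aC bC by (simp_all add: f_def)
  have "admissible f (insert (a, b) Q)" using fQ fab by (auto simp: admissible_def)
  moreover have "tilt f (insert (a, b) Q) = insert (b, a) Q"
    using fQ fab by (force simp: tilt_def)
  ultimately have "insert (b, a) Q \<in> toric_class n (insert (a, b) Q)"
    unfolding toric_class_eq_tilts[OF q] by fastforce
  from toric_class_eqI[OF this] show ?thesis by simp
qed

section \<open>The toric transitive closure\<close>

text \<open>The lift increases along the path, and the arc from its first to its last vertex keeps
  the total rise below one.\<close>

lemma toric_dipath_lift:
  assumes "toric_dipath n Q ys" "precedes_in ys i j" "toric_lift Q X"
  shows "X i < X j \<and> X j < X i + 1"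
proof -
  from assms(2) obtain k l where kl: "k < l" "l < length ys" "ys ! k = i" "ys ! l = j"
    by (auto simp: precedes_in_def)
  have "successively (\<lambda>x y. X x < X y) ys"
    by (rule successively_mono[where P = "\<lambda>x y. (x, y) \<in> Q"])
       (use assms in \<open>auto simp: toric_dipath_def toric_lift_def\<close>)
  then have "sorted_wrt (\<lambda>x y. X x < X y) ys"
    by (subst (asm) successively_conv_sorted_wrt) (auto simp: transp_def)
  then have less: "X (ys ! r) < X (ys ! s)" if "r < s" "s < length ys" for r s
    using that by (rule sorted_wrt_nth_less)
  have le: "X (ys ! r) \<le> X (ys ! s)" if "r \<le> s" "s < length ys" for r s
    using less[of r s] that by (cases "r = s") auto
  have ne: "ys \<noteq> []" and "length ys \<ge> 2" using kl by auto
  then have "X (last ys) < X (hd ys) + 1"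
    using assms(1,3) by (simp add: toric_dipath_def toric_lift_def)
  moreover have "X (hd ys) \<le> X i"
    using le[of 0 k] kl ne by (simp add: hd_conv_nth)
  moreover have "X j \<le> X (last ys)"
    using le[of l "length ys - 1"] kl ne by (simp add: last_conv_nth)
  ultimately show ?thesis using less[of k l] kl by simp
qed

text \<open>Every added arc runs along a toric directed path, so the same integer parts give a lift
  of the closure.\<close>

lemma liftable_toric_closure_iff: "liftable c (toric_closure n Q) \<longleftrightarrow> liftable c Q"
proof
  assume "liftable c (toric_closure n Q)"
  then show "liftable c Q" by (rule liftable_subset) (auto simp: toric_closure_def)
next
  assume "liftable c Q"
  then obtain f :: "nat \<Rightarrow> int" where f: "toric_lift Q (\<lambda>x. c x + f x)"
    by (auto simp: liftable_def)
  have "toric_lift (toric_closure n Q) (\<lambda>x. c x + f x)"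
    unfolding toric_lift_def
  proof (intro allI impI)
    fix x y assume "(x, y) \<in> toric_closure n Q"
    then consider "(x, y) \<in> Q" | ys where "toric_dipath n Q ys" "precedes_in ys x y"
      by (auto simp: toric_closure_def)
    then show "c x + f x < c y + f y \<and> c y + f y < c x + f x + 1"
    proof cases
      case 1
      then show ?thesis using f by (simp add: toric_lift_def)
    next
      case 2
      from toric_dipath_lift[OF this f] show ?thesis .
    qed
  qed
  then show "liftable c (toric_closure n Q)" unfolding liftable_def by blast
qed

lemma quiver_liftable:
  assumes "quiver n Q"
  shows "\<exists>c. liftable c Q"
proof -
  obtain g :: "nat \<Rightarrow> nat" where g: "\<And>x y. (x, y) \<in> Q \<Longrightarrow> g x < g y"
    using quiver_numbering[OF assms] by blast
  define m :: nat where "m = Suc (sum g {1..n})"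
  have le: "g x < m" if "x \<in> {1..n}" for x
    unfolding m_def using that by (intro le_imp_less_Suc member_le_sum) auto
  \<comment> \<open>A numbering scaled into [0,1) is its own lift, with all integer parts 0.\<close>
  have "toric_lift Q (\<lambda>x. g x / m + of_int ((\<lambda>_. 0) x))"
    unfolding toric_lift_def
  proof (intro allI impI)
    fix x y assume xy: "(x, y) \<in> Q"
    then have "g y < m" using assms le by (auto simp: quiver_def)
    then show "real (g x) / m + of_int 0 < real (g y) / m + of_int 0 \<and>
        real (g y) / m + of_int 0 < real (g x) / m + of_int 0 + 1"
      using g[OF xy] by (auto simp: field_simps)
  qed
  then show ?thesis unfolding liftable_def by (intro exI)
qed

text \<open>Acyclicity passes through lifts: \<open>Q\<close> has one, it is also a lift of the
  closure, and its values increase along every arc.\<close>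

lemma quiver_toric_closure:
  assumes "quiver n Q"
  shows "quiver n (toric_closure n Q)"
proof -
  have "i \<in> {1..n} \<and> j \<in> {1..n}" if "(i, j) \<in> toric_closure n Q" for i j
    using that assms precedes_in_set
    by (fastforce simp: toric_closure_def quiver_def toric_dipath_def)
  moreover have "acyclic (toric_closure n Q)"
    using quiver_liftable[OF assms] liftable_acyclic[of _ "toric_closure n Q"]
    unfolding liftable_toric_closure_iff by blast
  ultimately show ?thesis by (auto simp: quiver_def)
qed

lemma toric_extensions_toric_closure:
  assumes "quiver n Q"
  shows "toric_extensions n (toric_class n (toric_closure n Q)) = toric_extensions n (toric_class n Q)"
proof -
  have "Q \<subseteq> {1..n} \<times> {1..n}" "toric_closure n Q \<subseteq> {1..n} \<times> {1..n}"
    using assms quiver_toric_closure[OF assms] by (simp_all add: quiver_def)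
  then show ?thesis by (auto simp: toric_extensions_iff liftable_toric_closure_iff)
qed

section \<open>Toric extensions after adding an arc\<close>

lemma toric_extensions_insert:
  assumes Q: "quiver n Q" and ab: "a \<in> {1..n}" "b \<in> {1..n}"
    and conn: "(a, b) \<notin> (Q \<union> Q\<inverse>)\<^sup>*"
  shows "toric_extensions n (toric_class n (insert (a, b) Q)) = toric_extensions n (toric_class n Q)"
proof
  have sub: "Q \<subseteq> {1..n} \<times> {1..n}" and sub': "insert (a, b) Q \<subseteq> {1..n} \<times> {1..n}"
    using Q ab by (auto simp: quiver_def)
  have "a \<noteq> b" using conn by auto
  show "toric_extensions n (toric_class n (insert (a, b) Q)) \<subseteq> toric_extensions n (toric_class n Q)"
    by (rule toric_extensions_antimono[OF subset_insertI sub'])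
  show "toric_extensions n (toric_class n Q) \<subseteq> toric_extensions n (toric_class n (insert (a, b) Q))"
  proof
    fix W assume "W \<in> toric_extensions n (toric_class n Q)"
    then obtain p where W: "W \<in> toric_total_orders n" and p: "p \<in> total_order_chamber n W"
      and lift: "liftable (coord_mod1 p) Q"
      unfolding toric_extensions_iff[OF sub] by blast
    have tor: "p \<in> torus n" and inj: "inj_on (coord_mod1 p) {1..n}"
      using p by (simp_all add: total_order_chamber_def)
    \<comment> \<open>Points in the chamber of a total order have distinct coordinates, as the
      translation argument requires.\<close>
    have "coord_mod1 p a \<noteq> coord_mod1 p b" using inj_onD[OF inj _ ab] \<open>a \<noteq> b\<close> by blast
    from liftable_insert[OF lift conn this] coord_mod1_range[OF tor] ab
    have "liftable (coord_mod1 p) (insert (a, b) Q)" by blast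
    then show "W \<in> toric_extensions n (toric_class n (insert (a, b) Q))"
      unfolding toric_extensions_iff[OF sub'] using W p by blast
  qed
qed

text \<open>The lifts of \<open>a\<close> and \<open>b\<close> share the open unit interval above
  that of \<open>v\<close>, so they differ by less than one. One unchanged lift thus fits whichever
  new arc points upwards.\<close>

lemma toric_extensions_cone:
  assumes sub: "Q \<subseteq> {1..n} \<times> {1..n}" and ab: "a \<in> {1..n}" "b \<in> {1..n}" "a \<noteq> b"
    and v: "(v, a) \<in> Q" "(v, b) \<in> Q"
  shows "toric_extensions n (toric_class n Q) =
    toric_extensions n (toric_class n (insert (a, b) Q)) \<union>
    toric_extensions n (toric_class n (insert (b, a) Q))"
proof
  have sub1: "insert (a, b) Q \<subseteq> {1..n} \<times> {1..n}" and sub2: "insert (b, a) Q \<subseteq> {1..n} \<times> {1..n}"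
    using sub ab by auto
  show "toric_extensions n (toric_class n (insert (a, b) Q)) \<union>
      toric_extensions n (toric_class n (insert (b, a) Q)) \<subseteq> toric_extensions n (toric_class n Q)"
    using toric_extensions_antimono[OF subset_insertI sub1]
      toric_extensions_antimono[OF subset_insertI sub2] by blast
  show "toric_extensions n (toric_class n Q) \<subseteq>
      toric_extensions n (toric_class n (insert (a, b) Q)) \<union>
      toric_extensions n (toric_class n (insert (b, a) Q))"
  proof
    fix W assume "W \<in> toric_extensions n (toric_class n Q)"
    then obtain p where W: "W \<in> toric_total_orders n" and p: "p \<in> total_order_chamber n W"
      and lift: "liftable (coord_mod1 p) Q"
      unfolding toric_extensions_iff[OF sub] by blast
    have tor: "p \<in> torus n" and inj: "inj_on (coord_mod1 p) {1..n}"
      using p by (simp_all add: total_order_chamber_def)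
    obtain f :: "nat \<Rightarrow> int" where f: "toric_lift Q (\<lambda>x. coord_mod1 p x + f x)" (is "toric_lift Q ?X")
      using lift by (auto simp: liftable_def)
    have "?X a \<noteq> ?X b"
    proof
      assume eq: "?X a = ?X b"
      then have "frac (?X a) = frac (?X b)" by (rule arg_cong)
      then have "coord_mod1 p a = coord_mod1 p b"
        using coord_mod1_range[OF tor] ab by (simp add: frac_eq[THEN iffD2])
      then show False using inj_onD[OF inj _ ab(1,2)] \<open>a \<noteq> b\<close> by blast
    qed
    moreover have "?X v < ?X a" "?X a < ?X v + 1" "?X v < ?X b" "?X b < ?X v + 1"
      using f v by (simp_all add: toric_lift_def)
    ultimately have "toric_lift (insert (a, b) Q) ?X \<or> toric_lift (insert (b, a) Q) ?X"
      using f unfolding toric_lift_insert by linarith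
    then have "liftable (coord_mod1 p) (insert (a, b) Q) \<or> liftable (coord_mod1 p) (insert (b, a) Q)"
      unfolding liftable_def by blast
    then show "W \<in> toric_extensions n (toric_class n (insert (a, b) Q)) \<union>
        toric_extensions n (toric_class n (insert (b, a) Q))"
      unfolding Un_iff toric_extensions_iff[OF sub1] toric_extensions_iff[OF sub2]
      using W p by blast
  qed
qed

section \<open>The zigzag on four vertices\<close>

text \<open>An alternating orientation of the path 1 - 2 - 3 - 4: no two arcs compose, so the ends
  are incomparable although connected.\<close>

definition zigzag :: "(nat \<times> nat) set" where
  "zigzag = {(1, 2), (3, 2), (3, 4)}"

lemma trancl_zigzag: "zigzag\<^sup>+ = zigzag"
  by (rule trancl_id) (auto simp: zigzag_def trans_def)

lemma quiver_zigzag: "quiver 4 zigzag"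
  unfolding quiver_def acyclic_def trancl_zigzag by (auto simp: zigzag_def)

lemma ord_incomparable_zigzag: "\<not> ord_comparable zigzag 1 4"
  unfolding ord_comparable_def trancl_zigzag by (auto simp: zigzag_def)

lemma same_component_zigzag: "same_component (class_graph (toric_class 4 zigzag)) 1 4"
proof -
  have "(1, 2) \<in> zigzag \<union> zigzag\<inverse>" "(2, 3) \<in> zigzag \<union> zigzag\<inverse>" "(3, 4) \<in> zigzag \<union> zigzag\<inverse>"
    by (simp_all add: zigzag_def)
  then show ?thesis
    unfolding same_component_def adj_rel_toric_class[OF quiver_zigzag]
    by (meson converse_rtrancl_into_rtrancl r_into_rtrancl)
qed

lemma toric_incomparable_if_ord_incomparable:
  assumes "\<not> ord_comparable Q a b"
  shows "\<not> toric_comparable n (toric_class n Q) a b"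
  using assms self_in_toric_class by (auto simp: toric_comparable_def toric_chain_def)

text \<open>The cyclic order comes from the lift \<open>0, 0.9, 0.8, 1.7\<close> of the zigzag, in which the ends are
  more than one period apart.\<close>

lemma zigzag_proper:
  "toric_extensions 4 (toric_class 4 (insert (1, 4) zigzag)) \<union>
   toric_extensions 4 (toric_class 4 (insert (4, 1) zigzag)) \<subset>
   toric_extensions 4 (toric_class 4 zigzag)"
proof -
  let ?w = "[1, 4, 3, 2] :: nat list"
  have w: "?w \<in> permutations_of_set {1..4}"
    by (auto simp: permutations_of_set_def)
  have sub: "zigzag \<subseteq> {1..4} \<times> {1..4}" "insert (1, 4) zigzag \<subseteq> {1..4} \<times> {1..4}"
    "insert (4, 1) zigzag \<subseteq> {1..4} \<times> {1..4}"
    by (auto simp: zigzag_def)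
  note prec = precedes_in_Cons precedes_in_Nil
  have "list_liftable ?w zigzag"
    unfolding list_liftable_def
    \<comment> \<open>These are the integer parts of the lift; the fractional parts 0, 0.7, 0.8, 0.9
      belong to 1, 4, 3, 2 in this order.\<close>
    by (rule exI[of _ "\<lambda>x. if x = 4 then 1 else 0"]) (auto simp: zigzag_def prec)
  moreover have "\<not> list_liftable ?w (insert (1, 4) zigzag)"
  proof
    assume "list_liftable ?w (insert (1, 4) zigzag)"
    then obtain f :: "nat \<Rightarrow> int" where f: "(x, y) \<in> insert (1, 4) zigzag \<Longrightarrow>
        f y = f x \<and> precedes_in ?w x y \<or> f y = f x + 1 \<and> precedes_in ?w y x" for x y
      unfolding list_liftable_def by blast
    \<comment> \<open>The zigzag forces \<open>f 4 = f 1 + 1\<close>, but since 1 precedes 4 in the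
      list the new arc would need \<open>f 4 = f 1\<close>.\<close>
    show False using f[of 1 2] f[of 3 2] f[of 3 4] f[of 1 4] by (simp add: zigzag_def prec)
  qed
  moreover have "\<not> list_liftable ?w (insert (4, 1) zigzag)"
  proof
    assume "list_liftable ?w (insert (4, 1) zigzag)"
    then obtain f :: "nat \<Rightarrow> int" where f: "(x, y) \<in> insert (4, 1) zigzag \<Longrightarrow>
        f y = f x \<and> precedes_in ?w x y \<or> f y = f x + 1 \<and> precedes_in ?w y x" for x y
      unfolding list_liftable_def by blast
    \<comment> \<open>Here the new arc would need \<open>f 1 = f 4 + 1\<close>, again against
      \<open>f 4 = f 1 + 1\<close>.\<close>
    show False using f[of 1 2] f[of 3 2] f[of 3 4] f[of 4 1] by (simp add: zigzag_def prec)
  qed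
  ultimately have "rotation_class ?w \<in> toric_extensions 4 (toric_class 4 zigzag)"
    "rotation_class ?w \<notin> toric_extensions 4 (toric_class 4 (insert (1, 4) zigzag))"
    "rotation_class ?w \<notin> toric_extensions 4 (toric_class 4 (insert (4, 1) zigzag))"
    by (simp_all only: toric_extensions_rotation_class_iff[OF w] sub simp_thms)
  then show ?thesis
    using toric_extensions_antimono[OF subset_insertI sub(2)]
      toric_extensions_antimono[OF subset_insertI sub(3)] by blast
qed

theorem theorem7p1:
  shows
   "(\<comment> \<open>(i)\<close>
     \<forall>(n::nat) Q a b. quiver n Q \<and> a \<in> {1..n} \<and> b \<in> {1..n} \<and>
        \<not> toric_comparable n (toric_class n Q) a b \<and>
        \<not> same_component (class_graph (toric_class n Q)) a b \<longrightarrow>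
        toric_class n (insert (a, b) Q) = toric_class n (insert (b, a) Q) \<and>
        toric_extensions n (toric_class n Q) =
          toric_extensions n (toric_class n (insert (a, b) Q)) \<and>
        toric_extensions n (toric_class n (insert (a, b) Q)) =
          toric_extensions n (toric_class n (insert (b, a) Q)))
    \<and>
    (\<comment> \<open>(ii), inclusion\<close>
     \<forall>(n::nat) Q a b Q'. quiver n Q \<and> a \<in> {1..n} \<and> b \<in> {1..n} \<and>
        \<not> toric_comparable n (toric_class n Q) a b \<and>
        same_component (class_graph (toric_class n Q)) a b \<and>
        Q' \<in> toric_class n Q \<and> \<not> ord_comparable Q' a b \<longrightarrow>
        toric_extensions n (toric_class n (insert (a, b) Q')) \<subseteq>
          toric_extensions n (toric_class n Q) \<and>
        toric_extensions n (toric_class n (insert (b, a) Q')) \<subseteq>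
          toric_extensions n (toric_class n Q) \<and>
        toric_extensions n (toric_class n (insert (a, b) Q')) \<inter>
          toric_extensions n (toric_class n (insert (b, a) Q')) = {})
    \<and>
    (\<comment> \<open>(ii), properness\<close>
     \<exists>(n::nat) Q a b Q'. quiver n Q \<and> a \<in> {1..n} \<and> b \<in> {1..n} \<and>
        \<not> toric_comparable n (toric_class n Q) a b \<and>
        same_component (class_graph (toric_class n Q)) a b \<and>
        Q' \<in> toric_class n Q \<and> \<not> ord_comparable Q' a b \<and>
        toric_extensions n (toric_class n (insert (a, b) Q')) \<union>
          toric_extensions n (toric_class n (insert (b, a) Q')) \<subset>
          toric_extensions n (toric_class n Q))
    \<and>
    (\<comment> \<open>(iii)\<close>
     \<forall>(n::nat) Q a b v Q'. quiver n Q \<and> a \<in> {1..n} \<and> b \<in> {1..n} \<and>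
        \<not> toric_comparable n (toric_class n Q) a b \<and>
        at_distance (class_graph (toric_class n (toric_closure n Q))) 2 a b \<and>
        {a, v} \<in> class_graph (toric_class n (toric_closure n Q)) \<and>
        {b, v} \<in> class_graph (toric_class n (toric_closure n Q)) \<and>
        Q' \<in> toric_class n (toric_closure n Q) \<and> is_source n Q' v \<longrightarrow>
        toric_extensions n (toric_class n Q) =
          toric_extensions n (toric_class n (insert (a, b) Q')) \<union>
          toric_extensions n (toric_class n (insert (b, a) Q')) \<and>
        toric_extensions n (toric_class n (insert (a, b) Q')) \<inter>
          toric_extensions n (toric_class n (insert (b, a) Q')) = {})"
proof (intro conjI allI impI; (elim conjE)?)
  fix n :: nat and Q a b
  assume Q: "quiver n Q" and ab: "a \<in> {1..n}" "b \<in> {1..n}"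
    and "\<not> same_component (class_graph (toric_class n Q)) a b"
  then have conn: "(a, b) \<notin> (Q \<union> Q\<inverse>)\<^sup>*"
    by (simp add: same_component_def adj_rel_toric_class)
  show "toric_class n (insert (a, b) Q) = toric_class n (insert (b, a) Q)"
    by (rule toric_class_insert_reverse[OF Q ab conn])
  then show "toric_extensions n (toric_class n (insert (a, b) Q)) =
      toric_extensions n (toric_class n (insert (b, a) Q))" by simp
  show "toric_extensions n (toric_class n Q) =
      toric_extensions n (toric_class n (insert (a, b) Q))"
    by (rule toric_extensions_insert[OF Q ab conn, symmetric])
next
  fix n :: nat and Q a b Q'
  assume Q: "quiver n Q" and ab: "a \<in> {1..n}" "b \<in> {1..n}"
    and same: "same_component (class_graph (toric_class n Q)) a b"
    and Q': "Q' \<in> toric_class n Q"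
  have qQ': "quiver n Q'" by (rule quiver_toric_class[OF Q Q'])
  then have sub: "Q' \<subseteq> {1..n} \<times> {1..n}" by (simp add: quiver_def)
  then have sub': "insert (a, b) Q' \<subseteq> {1..n} \<times> {1..n}" "insert (b, a) Q' \<subseteq> {1..n} \<times> {1..n}"
    using ab by auto
  note cls = toric_class_eqI[OF Q']
  show "toric_extensions n (toric_class n (insert (a, b) Q')) \<subseteq> toric_extensions n (toric_class n Q)"
    "toric_extensions n (toric_class n (insert (b, a) Q')) \<subseteq> toric_extensions n (toric_class n Q)"
    using sub'[THEN toric_extensions_antimono[OF subset_insertI]] by (simp_all only: cls)
  show "toric_extensions n (toric_class n (insert (a, b) Q')) \<inter>
      toric_extensions n (toric_class n (insert (b, a) Q')) = {}"
    using same sub ab adj_rel_toric_class[OF qQ']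
    by (intro toric_extensions_disjoint) (simp_all add: same_component_def cls)
next
  show "\<exists>n Q a b Q'. quiver n Q \<and> a \<in> {1..n} \<and> b \<in> {1..n} \<and>
      \<not> toric_comparable n (toric_class n Q) a b \<and>
      same_component (class_graph (toric_class n Q)) a b \<and>
      Q' \<in> toric_class n Q \<and> \<not> ord_comparable Q' a b \<and>
      toric_extensions n (toric_class n (insert (a, b) Q')) \<union>
        toric_extensions n (toric_class n (insert (b, a) Q')) \<subset>
        toric_extensions n (toric_class n Q)"
    using quiver_zigzag same_component_zigzag ord_incomparable_zigzag zigzag_proper
      self_in_toric_class[of zigzag 4]
      toric_incomparable_if_ord_incomparable[OF ord_incomparable_zigzag, of 4]
    by (intro exI[of _ 4] exI[of _ zigzag] exI[of _ 1] conjI) simp_all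
next
  fix n :: nat and Q a b v Q'
  let ?P = "toric_class n (toric_closure n Q)"
  assume Q: "quiver n Q" and ab: "a \<in> {1..n}" "b \<in> {1..n}"
    and dist: "at_distance (class_graph ?P) 2 a b"
    and av: "{a, v} \<in> class_graph ?P" and bv: "{b, v} \<in> class_graph ?P"
    and Q': "Q' \<in> ?P" and v: "is_source n Q' v"
  have qQ': "quiver n Q'" by (rule quiver_toric_class[OF quiver_toric_closure[OF Q] Q'])
  then have sub: "Q' \<subseteq> {1..n} \<times> {1..n}" by (simp add: quiver_def)
  note cls = toric_class_eqI[OF Q']
  have adj: "adj_rel (class_graph ?P) = Q' \<union> Q'\<inverse>"
    using adj_rel_toric_class[OF qQ'] by (simp only: cls)
  \<comment> \<open>Both edges at \<open>v\<close> occur in \<open>Q'\<close> in some direction, and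
    at a source they point outwards.\<close>
  have va: "(v, a) \<in> Q'" and vb: "(v, b) \<in> Q'"
    using av bv v adj by (auto simp: adj_rel_def is_source_def)
  have "a \<noteq> b" using dist by (auto simp: at_distance_def dest: spec[of _ 0])
  then show "toric_extensions n (toric_class n Q) =
      toric_extensions n (toric_class n (insert (a, b) Q')) \<union>
      toric_extensions n (toric_class n (insert (b, a) Q'))"
    using toric_extensions_cone[OF sub ab _ va vb] toric_extensions_toric_closure[OF Q]
    by (simp add: cls)
  have "(a, v) \<in> Q' \<union> Q'\<inverse>" "(v, b) \<in> Q' \<union> Q'\<inverse>" using va vb by auto
  \<comment> \<open>The walk through \<open>v\<close> connects \<open>a\<close> and
    \<open>b\<close>, so the uniqueness of lifts up to a constant applies.\<close>
  then have "(a, b) \<in> (Q' \<union> Q'\<inverse>)\<^sup>*" by (meson rtrancl.intros)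
  then show "toric_extensions n (toric_class n (insert (a, b) Q')) \<inter>
      toric_extensions n (toric_class n (insert (b, a) Q')) = {}"
    by (rule toric_extensions_disjoint[OF sub ab])
qed

end
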